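(* Let $\mathbb{M}$ be a monster model of a complete $C$-minimal expansion of ACVF whose language contains a constant symbol $t$ with $v(t)>0$, and let $\Gamma$ be its value group. Let $a\in\Gamma$ and let $f:(a,+\infty)\to\Gamma$ be a definable linear function. Then there are a definable endomorphism $g$ of $(\Gamma,+)$ and a constant $c\in\Gamma$ such that $f(x)=g(x)+c$ for all $x\in(a,+\infty)$.
   Context: ACVF is the theory of algebraically closed non-trivially valued fields; $C$-minimal means every definable subset of the home sort is a finite boolean combination of balls and points. "Definable" means with parameters. A definable function $f$ on an interval $I\subseteq\Gamma$ is linear if $f(b)+f(b+\epsilon_1+\epsilon_2)=f(b+\epsilon_1)+f(b+\epsilon_2)$ whenever $b,b+\epsilon_1,b+\epsilon_2,b+\epsilon_1+\epsilon_2\in I$. *)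

theory Defs
  imports "HOL-Computational_Algebra.Polynomial"
begin

section \<open>First-order logic\<close>

datatype 'f tm = Var nat | App 'f "'f tm list"

datatype ('f, 'r) fm =
    Eq "'f tm" "'f tm"
  | Rel 'r "'f tm list"
  | Neg "('f, 'r) fm"
  | Conj "('f, 'r) fm" "('f, 'r) fm"
  | Ex nat "('f, 'r) fm"

record ('f, 'r) lang =
  fun_ar :: "'f \<Rightarrow> nat"
  rel_ar :: "'r \<Rightarrow> nat"

primrec wf_tm :: "('f, 'r) lang \<Rightarrow> 'f tm \<Rightarrow> bool" where
  "wf_tm L (Var i) \<longleftrightarrow> True"
| "wf_tm L (App f ts) \<longleftrightarrow> length ts = fun_ar L f \<and> (\<forall>b \<in> set (map (wf_tm L) ts). b)"

primrec wf_fm :: "('f, 'r) lang \<Rightarrow> ('f, 'r) fm \<Rightarrow> bool" where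
  "wf_fm L (Eq s t) \<longleftrightarrow> wf_tm L s \<and> wf_tm L t"
| "wf_fm L (Rel r ts) \<longleftrightarrow> length ts = rel_ar L r \<and> (\<forall>t\<in>set ts. wf_tm L t)"
| "wf_fm L (Neg \<phi>) \<longleftrightarrow> wf_fm L \<phi>"
| "wf_fm L (Conj \<phi> \<psi>) \<longleftrightarrow> wf_fm L \<phi> \<and> wf_fm L \<psi>"
| "wf_fm L (Ex i \<phi>) \<longleftrightarrow> wf_fm L \<phi>"

primrec fv_tm :: "'f tm \<Rightarrow> nat set" where
  "fv_tm (Var i) = {i}"
| "fv_tm (App f ts) = \<Union> (set (map fv_tm ts))"

primrec fv_fm :: "('f, 'r) fm \<Rightarrow> nat set" where
  "fv_fm (Eq s t) = fv_tm s \<union> fv_tm t"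
| "fv_fm (Rel r ts) = (\<Union>t\<in>set ts. fv_tm t)"
| "fv_fm (Neg \<phi>) = fv_fm \<phi>"
| "fv_fm (Conj \<phi> \<psi>) = fv_fm \<phi> \<union> fv_fm \<psi>"
| "fv_fm (Ex i \<phi>) = fv_fm \<phi> - {i}"

text \<open>
  The universe of a structure is the whole type \<open>'k\<close>.  The values of \<open>fun_int M f\<close> and
  \<open>rel_int M r\<close> on lists whose length is not the arity of the symbol are irrelevant.
\<close>
record ('f, 'r, 'k) fo_struct =
  fun_int :: "'f \<Rightarrow> 'k list \<Rightarrow> 'k"
  rel_int :: "'r \<Rightarrow> 'k list \<Rightarrow> bool"

primrec eval_tm :: "('f, 'r, 'k) fo_struct \<Rightarrow> (nat \<Rightarrow> 'k) \<Rightarrow> 'f tm \<Rightarrow> 'k" where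
  "eval_tm M e (Var i) = e i"
| "eval_tm M e (App f ts) = fun_int M f (map (eval_tm M e) ts)"

primrec sat :: "('f, 'r, 'k) fo_struct \<Rightarrow> (nat \<Rightarrow> 'k) \<Rightarrow> ('f, 'r) fm \<Rightarrow> bool" where
  "sat M e (Eq s t) \<longleftrightarrow> eval_tm M e s = eval_tm M e t"
| "sat M e (Rel r ts) \<longleftrightarrow> rel_int M r (map (eval_tm M e) ts)"
| "sat M e (Neg \<phi>) \<longleftrightarrow> \<not> sat M e \<phi>"
| "sat M e (Conj \<phi> \<psi>) \<longleftrightarrow> sat M e \<phi> \<and> sat M e \<psi>"
| "sat M e (Ex i \<phi>) \<longleftrightarrow> (\<exists>a. sat M (e(i := a)) \<phi>)"

text \<open>
  Definability with parameters.  The variables \<open>0, \<dots>, n - 1\<close> of \<open>\<phi>\<close> stand for the coordinates of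
  the tuple; every other free variable is a parameter, with value given by \<open>e\<close>.
\<close>
definition definable ::
    "('f, 'r) lang \<Rightarrow> ('f, 'r, 'k) fo_struct \<Rightarrow> nat \<Rightarrow> 'k list set \<Rightarrow> bool" where
  "definable L M n X \<longleftrightarrow>
     (\<exists>\<phi> e. wf_fm L \<phi> \<and>
        X = {xs. length xs = n \<and> sat M (\<lambda>i. if i < n then xs ! i else e i) \<phi>})"


section \<open>Monster models\<close>

text \<open>
  A formula over \<open>A\<close> in the single variable \<open>0\<close>, as a pair: the free variables other than \<open>0\<close> are
  parameters, with values in \<open>A\<close>.
\<close>
definition formulas_over ::
    "('f, 'r) lang \<Rightarrow> 'k set \<Rightarrow> (('f, 'r) fm \<times> (nat \<Rightarrow> 'k)) set" where
  "formulas_over L A = {(\<phi>, e). wf_fm L \<phi> \<and> (\<forall>i \<in> fv_fm \<phi> - {0}. e i \<in> A)}"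

definition realizes ::
    "('f, 'r, 'k) fo_struct \<Rightarrow> 'k \<Rightarrow> (('f, 'r) fm \<times> (nat \<Rightarrow> 'k)) set \<Rightarrow> bool" where
  "realizes M a p \<longleftrightarrow> (\<forall>(\<phi>, e) \<in> p. sat M (e(0 := a)) \<phi>)"

definition saturated ::
    "('f, 'r) lang \<Rightarrow> ('f, 'r, 'k) fo_struct \<Rightarrow> 'c rel \<Rightarrow> bool" where
  "saturated L M \<kappa> \<longleftrightarrow>
     (\<forall>A p. (card_of A, \<kappa>) \<in> ordLess \<and> p \<subseteq> formulas_over L A \<and>
        (\<forall>q \<subseteq> p. finite q \<longrightarrow> (\<exists>a. realizes M a q)) \<longrightarrow> (\<exists>a. realizes M a p))"

definition partial_elementary ::
    "('f, 'r) lang \<Rightarrow> ('f, 'r, 'k) fo_struct \<Rightarrow> 'k set \<Rightarrow> ('k \<Rightarrow> 'k) \<Rightarrow> bool" where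
  "partial_elementary L M A h \<longleftrightarrow>
     (\<forall>\<phi> e. wf_fm L \<phi> \<and> (\<forall>i \<in> fv_fm \<phi>. e i \<in> A) \<longrightarrow> sat M e \<phi> = sat M (h \<circ> e) \<phi>)"

definition automorphism ::
    "('f, 'r) lang \<Rightarrow> ('f, 'r, 'k) fo_struct \<Rightarrow> ('k \<Rightarrow> 'k) \<Rightarrow> bool" where
  "automorphism L M \<sigma> \<longleftrightarrow> bij \<sigma> \<and>
     (\<forall>f xs. length xs = fun_ar L f \<longrightarrow> fun_int M f (map \<sigma> xs) = \<sigma> (fun_int M f xs)) \<and>
     (\<forall>r xs. length xs = rel_ar L r \<longrightarrow> rel_int M r (map \<sigma> xs) = rel_int M r xs)"

definition strongly_homogeneous ::
    "('f, 'r) lang \<Rightarrow> ('f, 'r, 'k) fo_struct \<Rightarrow> 'c rel \<Rightarrow> bool" where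
  "strongly_homogeneous L M \<kappa> \<longleftrightarrow>
     (\<forall>A h. (card_of A, \<kappa>) \<in> ordLess \<and> partial_elementary L M A h \<longrightarrow>
        (\<exists>\<sigma>. automorphism L M \<sigma> \<and> (\<forall>x\<in>A. \<sigma> x = h x)))"

text \<open>
  The size of the monster is measured by a cardinal \<open>\<kappa>\<close> larger than the number of formulas, that
  is, larger than \<open>|L| + \<aleph>\<^sub>0\<close>.
\<close>
definition monster_model ::
    "('f, 'r) lang \<Rightarrow> ('f, 'r, 'k) fo_struct \<Rightarrow> 'c rel \<Rightarrow> bool" where
  "monster_model L M \<kappa> \<longleftrightarrow> Card_order \<kappa> \<and> (card_of {\<phi>. wf_fm L \<phi>}, \<kappa>) \<in> ordLess \<and>
     saturated L M \<kappa> \<and> strongly_homogeneous L M \<kappa>"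


section \<open>Expansions of valued fields\<close>

text \<open>
  The language of an expansion consists of the language of rings with divisibility together with
  arbitrary extra symbols.
\<close>
datatype 'f vf_fun = VF_zero | VF_one | VF_minus | VF_plus | VF_times | Extra_fun 'f
datatype 'r vf_rel = VF_div | Extra_rel 'r

primrec vf_fun_ar :: "('f \<Rightarrow> nat) \<Rightarrow> 'f vf_fun \<Rightarrow> nat" where
  "vf_fun_ar ar VF_zero = 0"
| "vf_fun_ar ar VF_one = 0"
| "vf_fun_ar ar VF_minus = 1"
| "vf_fun_ar ar VF_plus = 2"
| "vf_fun_ar ar VF_times = 2"
| "vf_fun_ar ar (Extra_fun f) = ar f"

primrec vf_rel_ar :: "('r \<Rightarrow> nat) \<Rightarrow> 'r vf_rel \<Rightarrow> nat" where
  "vf_rel_ar ar VF_div = 2"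
| "vf_rel_ar ar (Extra_rel r) = ar r"

definition vf_lang :: "('f, 'r) lang \<Rightarrow> ('f vf_fun, 'r vf_rel) lang" where
  "vf_lang L = \<lparr>fun_ar = vf_fun_ar (fun_ar L), rel_ar = vf_rel_ar (rel_ar L)\<rparr>"

text \<open>
  A non-trivial valuation on \<open>'k\<close> with value group the type \<open>'g\<close>.  The value \<open>+\<infinity>\<close> is not
  represented: \<open>v 0\<close> is a junk element of \<open>'g\<close>, and the case of \<open>0\<close> is always treated separately.
\<close>
definition nontrivial_valuation :: "('k::field \<Rightarrow> 'g::linordered_ab_group_add) \<Rightarrow> bool" where
  "nontrivial_valuation v \<longleftrightarrow>
     (\<forall>x y. x \<noteq> 0 \<and> y \<noteq> 0 \<longrightarrow> v (x * y) = v x + v y) \<and>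
     (\<forall>x y. x \<noteq> 0 \<and> y \<noteq> 0 \<and> x + y \<noteq> 0 \<longrightarrow> min (v x) (v y) \<le> v (x + y)) \<and>
     v ` (UNIV - {0}) = UNIV \<and>
     (\<exists>x. x \<noteq> 0 \<and> v x \<noteq> 0)"

text \<open>The class \<open>alg_closed_field\<close> of the home sort provides algebraic closedness.\<close>
definition acvf_expansion ::
    "('f vf_fun, 'r vf_rel, 'k::alg_closed_field) fo_struct \<Rightarrow>
     ('k \<Rightarrow> 'g::linordered_ab_group_add) \<Rightarrow> bool" where
  "acvf_expansion M v \<longleftrightarrow> nontrivial_valuation v \<and>
     fun_int M VF_zero [] = 0 \<and>
     fun_int M VF_one [] = 1 \<and>
     (\<forall>x. fun_int M VF_minus [x] = - x) \<and>
     (\<forall>x y. fun_int M VF_plus [x, y] = x + y) \<and>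
     (\<forall>x y. fun_int M VF_times [x, y] = x * y) \<and>
     (\<forall>x y. rel_int M VF_div [x, y] \<longleftrightarrow> y = 0 \<or> (x \<noteq> 0 \<and> v x \<le> v y))"

definition open_ball :: "('k::field \<Rightarrow> 'g::linordered_ab_group_add) \<Rightarrow> 'k \<Rightarrow> 'g \<Rightarrow> 'k set" where
  "open_ball v c \<gamma> = {x. x = c \<or> \<gamma> < v (x - c)}"

definition closed_ball :: "('k::field \<Rightarrow> 'g::linordered_ab_group_add) \<Rightarrow> 'k \<Rightarrow> 'g \<Rightarrow> 'k set" where
  "closed_ball v c \<gamma> = {x. x = c \<or> \<gamma> \<le> v (x - c)}"

inductive_set ball_combinations ::
    "('k::field \<Rightarrow> 'g::linordered_ab_group_add) \<Rightarrow> 'k set set"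
  for v :: "'k \<Rightarrow> 'g" where
  point: "{c} \<in> ball_combinations v"
| open_ball: "open_ball v c \<gamma> \<in> ball_combinations v"
| closed_ball: "closed_ball v c \<gamma> \<in> ball_combinations v"
| Compl: "X \<in> ball_combinations v \<Longrightarrow> - X \<in> ball_combinations v"
| Un: "X \<in> ball_combinations v \<Longrightarrow> Y \<in> ball_combinations v \<Longrightarrow> X \<union> Y \<in> ball_combinations v"

definition C_minimal ::
    "('f, 'r) lang \<Rightarrow> ('f, 'r, 'k::field) fo_struct \<Rightarrow>
     ('k \<Rightarrow> 'g::linordered_ab_group_add) \<Rightarrow> bool" where
  "C_minimal L M v \<longleftrightarrow>
     (\<forall>X. definable L M 1 ((\<lambda>x. [x]) ` X) \<longrightarrow> X \<in> ball_combinations v)"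


section \<open>Definability in the value group\<close>

text \<open>
  The value group is the imaginary sort \<open>K\<^sup>\<times> / O\<^sup>\<times>\<close>, so a set of \<open>n\<close>-tuples in it is definable
  iff its preimage under the valuation is a definable subset of the \<open>n\<close>-th power of \<open>K\<^sup>\<times>\<close>.
\<close>
definition value_definable ::
    "('f, 'r) lang \<Rightarrow> ('f, 'r, 'k::field) fo_struct \<Rightarrow>
     ('k \<Rightarrow> 'g::linordered_ab_group_add) \<Rightarrow> nat \<Rightarrow> 'g list set \<Rightarrow> bool" where
  "value_definable L M v n Y \<longleftrightarrow> (\<forall>ys\<in>Y. length ys = n) \<and>
     definable L M n {xs. length xs = n \<and> 0 \<notin> set xs \<and> map v xs \<in> Y}"

text \<open>The function with domain \<open>I\<close> is represented by its graph; values outside \<open>I\<close> are ignored.\<close>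
definition definable_value_fun ::
    "('f, 'r) lang \<Rightarrow> ('f, 'r, 'k::field) fo_struct \<Rightarrow>
     ('k \<Rightarrow> 'g::linordered_ab_group_add) \<Rightarrow> 'g set \<Rightarrow> ('g \<Rightarrow> 'g) \<Rightarrow> bool" where
  "definable_value_fun L M v I f \<longleftrightarrow> value_definable L M v 2 ((\<lambda>x. [x, f x]) ` I)"

definition linear_fun_on :: "'g::ab_group_add set \<Rightarrow> ('g \<Rightarrow> 'g) \<Rightarrow> bool" where
  "linear_fun_on I f \<longleftrightarrow>
     (\<forall>b \<epsilon>\<^sub>1 \<epsilon>\<^sub>2. b \<in> I \<and> b + \<epsilon>\<^sub>1 \<in> I \<and> b + \<epsilon>\<^sub>2 \<in> I \<and> b + \<epsilon>\<^sub>1 + \<epsilon>\<^sub>2 \<in> I \<longrightarrow>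
        f b + f (b + \<epsilon>\<^sub>1 + \<epsilon>\<^sub>2) = f (b + \<epsilon>\<^sub>1) + f (b + \<epsilon>\<^sub>2))"

end

theory Submission
  imports Defs
begin

text \<open>
  Since \<open>{a<..}\<close> contains a translate of every finite subset of the value group, the increment
  \<open>f (b + x) - f b\<close> makes sense for every \<open>x\<close> once \<open>b\<close> is large; linearity says that it does not
  depend on \<open>b\<close>, and then that it is additive in \<open>x\<close>.  Its graph is obtained from the graph of \<open>f\<close>
  by quantifying over \<open>b\<close> and \<open>f b\<close>, which uses only the multiplication of the field.
\<close>

lemma linear_fun_on_greaterThan_imp_additive:
  fixes f :: "'g::linordered_ab_group_add \<Rightarrow> 'g" and \<epsilon> :: 'g
  assumes lin: "linear_fun_on {a<..} f" and "0 < \<epsilon>"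
  obtains g c where "additive g" "\<And>x. a < x \<Longrightarrow> f x = g x + c"
proof -
  \<comment> \<open>The base point must satisfy both \<open>a < b\<close> and
    \<open>a < b + x\<close>; adding the positive \<open>\<epsilon>\<close> makes both inequalities
    strict.\<close>
  define g where "g x = (let b = max a (a - x) + \<epsilon> in f (b + x) - f b)" for x
  have g_eq: "g x = f (b + x) - f b" if "a < b" "a < b + x" for x b
  proof -
    define d where "d = max a (a - x) + \<epsilon>"
    have "max a (a - x) < d"
      using \<open>0 < \<epsilon>\<close> unfolding d_def by (rule less_add_same_cancel1[THEN iffD2])
    then have "a < d" "a < d + x"
      by (simp_all add: diff_less_eq)
    \<comment> \<open>The increments \<open>d - b\<close> and \<open>x\<close> at \<open>b\<close>
      give the points \<open>d\<close>, \<open>b + x\<close> and \<open>d + x\<close>, all in the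
      interval; so the increment along \<open>x\<close> is the same at \<open>b\<close> and at
      \<open>d\<close>.\<close>
    have "f b + f (d + x) = f d + f (b + x)"
      using lin[unfolded linear_fun_on_def, rule_format, of b "d - b" x]
        \<open>a < d\<close> \<open>a < d + x\<close> that by simp
    then have "f (d + x) - f d = f (b + x) - f b" by (simp add: algebra_simps)
    then show ?thesis by (simp add: g_def Let_def d_def)
  qed
  have add: "additive g"
  proof
    fix x y
    \<comment> \<open>From this \<open>b\<close> the walk to \<open>b + x\<close> and on to
      \<open>b + x + y\<close> stays in the interval, so the two increments telescope.\<close>
    define b where "b = max (max a (a - x)) (a - (x + y)) + \<epsilon>"
    have "max (max a (a - x)) (a - (x + y)) < b"
      using \<open>0 < \<epsilon>\<close> unfolding b_def by (rule less_add_same_cancel1[THEN iffD2])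
    then have b: "a < b" "a < b + x" "a < b + x + y"
      by (simp_all add: diff_less_eq add.assoc)
    show "g (x + y) = g x + g y"
      using g_eq[of b "x + y"] g_eq[of b x] g_eq[of "b + x" y] b by (simp add: add.assoc)
  qed
  define b where "b = a + \<epsilon>"
  have "a < b" using \<open>0 < \<epsilon>\<close> by (simp add: b_def)
  \<comment> \<open>Any base point in the interval yields the constant:
    \<open>f x - f b = g (x - b) = g x - g b\<close>.\<close>
  have "f x = g x + (f b - g b)" if "a < x" for x
    using g_eq[of b "x - b"] \<open>a < b\<close> that additive.diff[OF add] by (simp add: algebra_simps)
  with add show thesis by (rule that)
qed

lemma eval_tm_cong: "(\<And>i. i \<in> fv_tm s \<Longrightarrow> e i = e' i) \<Longrightarrow> eval_tm M e s = eval_tm M e' s"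
proof (induction s)
  case (App f ts)
  then have "map (eval_tm M e) ts = map (eval_tm M e') ts" by auto
  then show ?case by (simp only: eval_tm.simps)
qed simp

lemma sat_cong: "(\<And>i. i \<in> fv_fm \<phi> \<Longrightarrow> e i = e' i) \<Longrightarrow> sat M e \<phi> = sat M e' \<phi>"
proof (induction \<phi> arbitrary: e e')
  case (Eq s t)
  then show ?case using eval_tm_cong[of s e e' M] eval_tm_cong[of t e e' M] by simp
next
  case (Rel r ts)
  then have "map (eval_tm M e) ts = map (eval_tm M e') ts" by (auto intro!: eval_tm_cong)
  then show ?case by (simp only: sat.simps)
next
  case (Neg \<phi>)
  have "sat M e \<phi> = sat M e' \<phi>"
    using Neg.prems by (intro Neg.IH) simp
  then show ?case by simp
next
  case (Conj \<phi> \<psi>)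
  have "sat M e \<phi> = sat M e' \<phi>" "sat M e \<psi> = sat M e' \<psi>"
    using Conj.prems by (intro Conj.IH; simp)+
  then show ?case by simp
next
  case (Ex i \<phi>)
  have "sat M (e(i := x)) \<phi> = sat M (e'(i := x)) \<phi>" for x
    using Ex.prems by (intro Ex.IH) auto
  then show ?case by simp
qed

lemma finite_fv_tm: "finite (fv_tm s)"
  by (induction s) auto

lemma finite_fv_fm: "finite (fv_fm \<phi>)"
  by (induction \<phi>) (auto simp: finite_fv_tm)

text \<open>Coordinatewise quotients of points of \<open>X\<close> become, under the valuation,
  differences of points of the graph of \<open>f\<close>. Multiplying by \<open>u\<close> and
  \<open>w\<close> keeps the defining formula in the home sort and avoids division.\<close>

lemma definable_quotients:
  fixes M :: "('f vf_fun, 'r vf_rel, 'k::times) fo_struct"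
  assumes times: "\<And>x y. fun_int M VF_times [x, y] = x * y"
    and X: "definable (vf_lang L) M 2 X"
  shows "definable (vf_lang L) M 2 {[x, y] |x y. \<exists>u w. [u, w] \<in> X \<and> [x * u, y * w] \<in> X}"
proof -
  obtain \<phi> e where wf: "wf_fm (vf_lang L) \<phi>"
    and X_eq: "X = {xs. length xs = 2 \<and> sat M (\<lambda>i. if i < 2 then xs ! i else e i) \<phi>}"
    using X unfolding definable_def by blast
  obtain m where m: "\<And>i. i \<in> fv_fm \<phi> \<Longrightarrow> i < m"
    using finite_fv_fm finite_nat_set_iff_bounded by metis
  \<comment> \<open>From \<open>n\<close> on, variables are neither free in \<open>\<phi>\<close>
    nor one of the coordinates 0 and 1, so binding them disturbs no parameter.\<close>
  define n where "n = m + 2"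
  have fresh: "\<And>i. i \<in> fv_fm \<phi> \<Longrightarrow> i < n" "2 \<le> n"
    using m by (force simp: n_def)+
  \<comment> \<open>Substitution of variables is simulated by rebinding the variables 0 and 1.\<close>
  define at_vars where
    "at_vars i j = Ex 0 (Ex 1 (Conj (Conj (Eq (Var 0) (Var i)) (Eq (Var 1) (Var j))) \<phi>))" for i j
  \<comment> \<open>The bounds on \<open>i\<close> and \<open>j\<close> keep their values from being
    overwritten when 0 and 1 are rebound.\<close>
  have sat_at_vars: "sat M E (at_vars i j) \<longleftrightarrow> [E i, E j] \<in> X"
    if "2 \<le> i" "2 \<le> j" "\<And>l. 2 \<le> l \<Longrightarrow> l < n \<Longrightarrow> E l = e l" for E i j
  proof -
    have "sat M E (at_vars i j) \<longleftrightarrow> sat M (E(0 := E i, 1 := E j)) \<phi>"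
      using that by (auto simp: at_vars_def)
    also have "\<dots> \<longleftrightarrow> sat M (\<lambda>l. if l < 2 then [E i, E j] ! l else e l) \<phi>"
      using fresh(1) that(3) by (intro sat_cong) (auto simp: less_2_cases_iff)
    finally show ?thesis by (simp add: X_eq)
  qed
  \<comment> \<open>The four bound variables hold \<open>u\<close>, \<open>w\<close>,
    \<open>x * u\<close> and \<open>y * w\<close>; the products need names because
    \<open>at_vars\<close> takes only variables.\<close>
  define \<psi> where "\<psi> = Ex n (Ex (n + 1) (Ex (n + 2) (Ex (n + 3)
    (Conj (Conj (Eq (Var (n + 2)) (App VF_times [Var 0, Var n]))
                (Eq (Var (n + 3)) (App VF_times [Var 1, Var (n + 1)])))
          (Conj (at_vars n (n + 1)) (at_vars (n + 2) (n + 3)))))))"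
  have "wf_fm (vf_lang L) \<psi>"
    using wf by (simp add: \<psi>_def at_vars_def vf_lang_def)
  moreover have "sat M (\<lambda>i. if i < 2 then [x, y] ! i else e i) \<psi> \<longleftrightarrow>
      (\<exists>u w. [u, w] \<in> X \<and> [x * u, y * w] \<in> X)" for x y
    using fresh(2) by (simp add: \<psi>_def times sat_at_vars)
  ultimately show ?thesis
    unfolding definable_def
    by (intro exI[of _ \<psi>] exI[of _ e]) (auto simp: length_Suc_conv numeral_2_eq_2)
qed

text \<open>In a difference of two points of the graph of \<open>f\<close> the constant
  \<open>c\<close> cancels, leaving a point of the graph of \<open>g\<close>; every point of that
  graph arises so, since the interval is unbounded above.\<close>

lemma definable_value_fun_additive_extension:
  fixes v :: "'k::alg_closed_field \<Rightarrow> 'g::linordered_ab_group_add"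
  assumes acvf: "acvf_expansion M v" and "0 < (\<epsilon> :: 'g)"
    and f_def: "definable_value_fun (vf_lang L) M v {a<..} f"
    and g: "additive g" "\<And>x. a < x \<Longrightarrow> f x = g x + c"
  shows "definable_value_fun (vf_lang L) M v UNIV g"
proof -
  have times: "\<And>x y. fun_int M VF_times [x, y] = x * y"
    and v_mult: "\<And>x y. x \<noteq> 0 \<Longrightarrow> y \<noteq> 0 \<Longrightarrow> v (x * y) = v x + v y"
    and v_surj: "v ` (UNIV - {0}) = UNIV"
    using acvf by (auto simp: acvf_expansion_def nontrivial_valuation_def)
  define X where "X = {xs. length xs = 2 \<and> 0 \<notin> set xs \<and> map v xs \<in> (\<lambda>x. [x, f x]) ` {a<..}}"
  have X_iff: "[u, w] \<in> X \<longleftrightarrow> u \<noteq> 0 \<and> w \<noteq> 0 \<and> a < v u \<and> v w = f (v u)" for u w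
    by (auto simp: X_def)
  have "(\<exists>u w. [u, w] \<in> X \<and> [x * u, y * w] \<in> X) \<longleftrightarrow> x \<noteq> 0 \<and> y \<noteq> 0 \<and> v y = g (v x)" for x y
  proof
    assume "\<exists>u w. [u, w] \<in> X \<and> [x * u, y * w] \<in> X"
    then obtain u w where "[u, w] \<in> X" "[x * u, y * w] \<in> X" by blast
    then show "x \<noteq> 0 \<and> y \<noteq> 0 \<and> v y = g (v x)"
      by (auto simp: X_iff v_mult g(2) additive.add[OF g(1)] add.assoc)
  next
    assume xy: "x \<noteq> 0 \<and> y \<noteq> 0 \<and> v y = g (v x)"
    \<comment> \<open>Here \<open>b\<close> and \<open>v x + b\<close> both lie in the interval, and
      surjectivity of \<open>v\<close> lifts \<open>b\<close> and \<open>f b\<close> to the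
      witnesses \<open>u\<close> and \<open>w\<close>.\<close>
    define b where "b = max a (a - v x) + \<epsilon>"
    have "max a (a - v x) < b"
      using \<open>0 < \<epsilon>\<close> unfolding b_def by (rule less_add_same_cancel1[THEN iffD2])
    then have b: "a < b" "a < v x + b"
      by (simp_all add: diff_less_eq add.commute)
    obtain u w where uw: "u \<noteq> 0" "v u = b" "w \<noteq> 0" "v w = f b"
      using v_surj by (metis DiffE UNIV_I imageE singletonI)
    have "[u, w] \<in> X \<and> [x * u, y * w] \<in> X"
      using xy b uw by (simp add: X_iff v_mult g(2) additive.add[OF g(1)] add.assoc)
    then show "\<exists>u w. [u, w] \<in> X \<and> [x * u, y * w] \<in> X" by blast
  qed
  then have "{[x, y] |x y. \<exists>u w. [u, w] \<in> X \<and> [x * u, y * w] \<in> X} =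
      {xs. length xs = 2 \<and> 0 \<notin> set xs \<and> map v xs \<in> range (\<lambda>x. [x, g x])}"
    by (auto simp: length_Suc_conv numeral_2_eq_2)
  moreover have "definable (vf_lang L) M 2 X"
    using f_def by (simp add: definable_value_fun_def value_definable_def X_def)
  ultimately show ?thesis
    using definable_quotients[OF times] by (force simp: definable_value_fun_def value_definable_def)
qed

theorem theorem5p1:
  fixes L\<^sub>0 :: "('f, 'r) lang"
    and M :: "('f vf_fun, 'r vf_rel, 'k::alg_closed_field) fo_struct"
    and v :: "'k \<Rightarrow> 'g::linordered_ab_group_add"
    and \<kappa> :: "'c rel"
    and t :: "'f vf_fun"
    and a :: 'g
    and f :: "'g \<Rightarrow> 'g"
  defines "L \<equiv> vf_lang L\<^sub>0"
  assumes monster: "monster_model L M \<kappa>"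
    and acvf: "acvf_expansion M v"
    and C_min: "C_minimal L M v"
    and t_const: "fun_ar L t = 0"
    and t_pos: "fun_int M t [] \<noteq> 0 \<and> 0 < v (fun_int M t [])"
    and f_def: "definable_value_fun L M v {a<..} f"
    and f_lin: "linear_fun_on {a<..} f"
  shows "\<exists>g c. definable_value_fun L M v UNIV g \<and> additive g \<and> (\<forall>x\<in>{a<..}. f x = g x + c)"
proof -
  \<comment> \<open>The value of the constant \<open>t\<close> serves as the positive
    \<open>\<epsilon>\<close>.\<close>
  obtain g c where g: "additive g" "\<And>x. a < x \<Longrightarrow> f x = g x + c"
    using linear_fun_on_greaterThan_imp_additive[OF f_lin] t_pos by blast
  moreover have "definable_value_fun L M v UNIV g"
    using definable_value_fun_additive_extension[OF acvf conjunct2[OF t_pos] _ g] f_def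
    unfolding L_def by blast
  ultimately show ?thesis by auto
qed

end
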